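(* Let $\alpha,\beta$ denote arbitrary ordinals, unless said otherwise. Consider sets $Z$, families $\mathcal{Y}\subseteq\mathcal{P}(Z)$ and functions $\mu:\mathcal{Y}\to\mathcal{P}(Z)$. In (1)–(6), $(\mu PR)$ and $(\mu\subseteq)$ are assumed to hold; in (7) only $(\mu\subseteq)$ is assumed. An implication "$A\to B$" means that every such $(Z,\mathcal{Y},\mu)$ satisfying $A$ satisfies $B$; "$A\not\to B$" means that there is such a $(Z,\mathcal{Y},\mu)$ satisfying $A$ but not $B$. (1) Downward: (1.1) $(\mu Cum\,\alpha)\to(\mu Cum\,\beta)$ for all $\beta\le\alpha$. (1.2) $(\mu Cumt\,\alpha)\to(\mu Cumt\,\beta)$ for all $\beta\le\alpha$. (2) Validity of $(\mu Cum\,\alpha)$ and $(\mu Cumt\,\alpha)$: (2.1) All $(\mu Cum\,\alpha)$ hold in smooth preferential structures. (2.2) All $(\mu Cumt\,\alpha)$ hold in transitive smooth preferential structures. (2.3) $(\mu Cumt\,\alpha)$ for $0<\alpha$ do not necessarily hold in smooth structures without transitivity, even in the presence of $(\bigcap)$. (3) Upward: (3.1) $(\mu Cum\,\beta)+(\cup)\to(\mu Cum\,\alpha)$ for all $\beta\le\alpha$. (3.2) $(\mu Cumt\,\beta)+(\cup)\to(\mu Cumt\,\alpha)$ for all $\beta\le\alpha$. (3.3) $\{(\mu Cumt\,\beta):\beta<\alpha\}+(\mu CUM)+(\bigcap)\not\to(\mu Cum\,\alpha)$ for $\alpha>0$. (4) Connection between $(\mu Cum\,\alpha)$ and $(\mu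 Cumt\,\alpha)$: (4.1) $(\mu Cumt\,\alpha)\to(\mu Cum\,\alpha)$. (4.2) $(\mu Cum\,\alpha)+(\bigcap)\not\to(\mu Cumt\,\alpha)$. (4.3) $(\mu Cum\,\alpha)+(\cup)\to(\mu Cumt\,\alpha)$. (5) $(\mu CUM)$ and $(\mu Cum\,\alpha)$: (5.1) $(\mu CUM)+(\cup)$ entail, for all $A,B,X,Y,U\in\mathcal{Y}$: (5.1.1) if $\mu(A)\subseteq B$, then $\mu(A\cup B)=\mu(B)$; (5.1.2) if $\mu(X)\subseteq U$ and $U\subseteq Y$, then $\mu(Y\cup X)=\mu(Y)$; (5.1.3) if $\mu(X)\subseteq U$ and $U\subseteq Y$, then $\mu(Y)\cap X\subseteq\mu(U)$. (5.2) $(\mu Cum\,\alpha)\to(\mu CUM)$ for all $\alpha$. (5.3) $(\mu CUM)+(\cup)\to(\mu Cum\,\alpha)$ for all $\alpha$. (5.4) $(\mu CUM)+(\cap)\to(\mu Cum\,0)$. (6) $(\mu CUM)$ and $(\mu Cumt\,\alpha)$: (6.1) $(\mu Cumt\,\alpha)\to(\mu CUM)$ for all $\alpha$. (6.2) $(\mu CUM)+(\cup)\to(\mu Cumt\,\alpha)$ for all $\alpha$. (6.3) $(\mu CUM)\not\to(\mu Cumt\,\alpha)$ for all $\alpha>0$. (7) $(\mu Cum\,0)\to(\mu PR)$.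
   Context: $\mathcal{P}(Z)$ denotes the power set of $Z$. For a family $\mathcal{Y}\subseteq\mathcal{P}(Z)$ and a function $\mu:\mathcal{Y}\to\mathcal{P}(Z)$ the following conditions are used. All sets named $U$, $X$, $Y$, $X_\gamma$ in these conditions range over elements of $\mathcal{Y}$. - $(\mu\subseteq)$: $\mu(X)\subseteq X$ for all $X$. - $(\mu PR)$: $X\subseteq Y$ implies $\mu(Y)\cap X\subseteq\mu(X)$. - $(\mu CUM)$: $\mu(X)\subseteq Y\subseteq X$ implies $\mu(X)=\mu(Y)$. - $(\cap)$: $\mathcal{Y}$ is closed under finite intersections. $(\bigcap)$: $\mathcal{Y}$ is closed under arbitrary intersections. $(\cup)$: $\mathcal{Y}$ is closed under finite unions. - $(\mu Cum\,\alpha)$, for an ordinal $\alpha$: for all $U$ and all sequences $(X_\gamma)_{\gamma\le\alpha}$, if $\mu(X_\beta)\subseteq U\cup\bigcup\{X_\gamma:\gamma<\beta\}$ for all $\beta\le\alpha$, then $\bigcap\{X_\gamma:\gamma\le\alpha\}\cap\mu(U)\subseteq\mu(X_\alpha)$. - $(\mu Cumt\,\alpha)$, for an ordinal $\alpha$: for all $U$ and all sequences $(X_\gamma)_{\gamma\le\alpha}$, if $\mu(X_\beta)\subseteq U\cup\bigcup\{X_\gamma:\gamma<\beta\}$ for all $\beta\le\alpha$, then $X_\alpha\cap\mu(U)\subseteq\mu(X_\alpha)$. Preferential structures. A preferential structure (with copies) is a pair $\mathcal{M}=\langle\mathcal{U},\prec\rangle$, where $\mathcal{U}$ is an arbitrary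 set of pairs $\langle x,i\rangle$ ($\langle x,i\rangle$ is regarded as the copy of $x$ with index $i$) and $\prec$ is an arbitrary binary relation on $\mathcal{U}$. It defines, for a set $X$, $$\mu_{\mathcal{M}}(X)=\{x\in X:\ \exists\langle x,i\rangle\in\mathcal{U}\ \neg\exists\langle x',i'\rangle\in\mathcal{U}\,(x'\in X\wedge\langle x',i'\rangle\prec\langle x,i\rangle)\}.$$ In the version without copies, $\mathcal{M}=\langle W,\prec\rangle$ with $W$ a set and $\prec$ a binary relation on $W$, and $\mu_{\mathcal{M}}(X)=\{x\in X\cap W:\neg\exists x'\in X\cap W\ (x'\prec x)\}$. The structure is transitive iff $\prec$ is transitive. $\mathcal{M}$ is $\mathcal{Y}$-smooth iff, whenever $x\in X\in\mathcal{Y}$ and $\langle x,i\rangle\in\mathcal{U}$, either there is no $\langle x',i'\rangle\in\mathcal{U}$ with $x'\in X$ and $\langle x',i'\rangle\prec\langle x,i\rangle$, or there is $\langle x',i'\rangle\in\mathcal{U}$ with $x'\in X$, $\langle x',i'\rangle\prec\langle x,i\rangle$, such that there is no $\langle x'',i''\rangle\in\mathcal{U}$ with $x''\in X$ and $\langle x'',i''\rangle\prec\langle x',i'\rangle$. (Without copies: whenever $x\in X\in\mathcal{Y}$, either $x\in\mu_{\mathcal{M}}(X)$ or there is $x'\in\mu_{\mathcal{M}}(X)$ with $x'\prec x$.) A condition "holds in a (smooth) preferential structure" $\mathcal{M}$ means that it holds for $\mu=\mu_{\mathcal{M}}$ restricted to $\mathcal{Y}$, where "smooth" means $\mathcal{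Y}$-smooth.
   Formalization: In (4.2) the non-implication from (μCum α)+(⋂) to (μCumt α) is stated and proved only for α > 0; for α = 0 the conditions (μCum 0) and (μCumt 0) coincide, so the claim fails there. *)

theory Defs
  imports Main
begin

text \<open>
  A sequence of length \<^prop>\<open>\<gamma> \<le> \<alpha>\<close> is a total function on a well-ordered type of which only
  the values up to \<open>\<alpha>\<close> matter, so an ordinal is an element of an arbitrary type of class
  \<^class>\<open>wellorder\<close>: the ordinal \<open>\<alpha>\<close> is the order type of its set of predecessors.
  Likewise only the values of \<open>\<mu>\<close> on members of the family \<open>\<Y>\<close> matter.

  The existence of a counterexample is asserted over a fixed type of points. Refuting a
  condition for \<open>\<alpha>\<close> while keeping it below \<open>\<alpha>\<close> takes a set that grows with \<open>\<alpha>\<close>, whence the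
  type \<^typ>\<open>'o \<times> 'o + nat\<close>; otherwise \<^typ>\<open>nat\<close> suffices.
\<close>

definition ord_zero :: "'o::wellorder" where
  "ord_zero = (LEAST \<gamma>. True)"

lemma ord_zero_le [simp]: "ord_zero \<le> \<gamma>"
  unfolding ord_zero_def by (rule Least_le) simp

definition mu_Sub :: "'z set set \<Rightarrow> ('z set \<Rightarrow> 'z set) \<Rightarrow> bool" where
  "mu_Sub \<Y> \<mu> \<longleftrightarrow> (\<forall>X\<in>\<Y>. \<mu> X \<subseteq> X)"

definition mu_PR :: "'z set set \<Rightarrow> ('z set \<Rightarrow> 'z set) \<Rightarrow> bool" where
  "mu_PR \<Y> \<mu> \<longleftrightarrow> (\<forall>X\<in>\<Y>. \<forall>Y\<in>\<Y>. X \<subseteq> Y \<longrightarrow> \<mu> Y \<inter> X \<subseteq> \<mu> X)"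

definition mu_CUM :: "'z set set \<Rightarrow> ('z set \<Rightarrow> 'z set) \<Rightarrow> bool" where
  "mu_CUM \<Y> \<mu> \<longleftrightarrow> (\<forall>X\<in>\<Y>. \<forall>Y\<in>\<Y>. \<mu> X \<subseteq> Y \<and> Y \<subseteq> X \<longrightarrow> \<mu> X = \<mu> Y)"

definition mu_Cum :: "'z set set \<Rightarrow> ('z set \<Rightarrow> 'z set) \<Rightarrow> 'o::wellorder \<Rightarrow> bool" where
  "mu_Cum \<Y> \<mu> \<alpha> \<longleftrightarrow>
    (\<forall>U\<in>\<Y>. \<forall>X. (\<forall>\<gamma>\<le>\<alpha>. X \<gamma> \<in> \<Y>) \<longrightarrow>
      (\<forall>\<beta>\<le>\<alpha>. \<mu> (X \<beta>) \<subseteq> U \<union> (\<Union>\<gamma>\<in>{..<\<beta>}. X \<gamma>)) \<longrightarrow>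
      (\<Inter>\<gamma>\<in>{..\<alpha>}. X \<gamma>) \<inter> \<mu> U \<subseteq> \<mu> (X \<alpha>))"

definition mu_Cumt :: "'z set set \<Rightarrow> ('z set \<Rightarrow> 'z set) \<Rightarrow> 'o::wellorder \<Rightarrow> bool" where
  "mu_Cumt \<Y> \<mu> \<alpha> \<longleftrightarrow>
    (\<forall>U\<in>\<Y>. \<forall>X. (\<forall>\<gamma>\<le>\<alpha>. X \<gamma> \<in> \<Y>) \<longrightarrow>
      (\<forall>\<beta>\<le>\<alpha>. \<mu> (X \<beta>) \<subseteq> U \<union> (\<Union>\<gamma>\<in>{..<\<beta>}. X \<gamma>)) \<longrightarrow>
      X \<alpha> \<inter> \<mu> U \<subseteq> \<mu> (X \<alpha>))"

text \<open>
  The empty union and the empty intersection are treated so that the two finitary conditions,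
  which serve as hypotheses, are as weak as possible, and the infinitary one, which is only
  claimed of counterexamples, is as strong as possible: there the empty intersection, taken
  in \<open>Z\<close>, is \<open>Z\<close>.
\<close>

definition fin_Un_closed :: "'z set set \<Rightarrow> bool" where
  "fin_Un_closed \<Y> \<longleftrightarrow> (\<forall>S. S \<subseteq> \<Y> \<and> finite S \<and> S \<noteq> {} \<longrightarrow> \<Union>S \<in> \<Y>)"

definition fin_Int_closed :: "'z set set \<Rightarrow> bool" where
  "fin_Int_closed \<Y> \<longleftrightarrow> (\<forall>S. S \<subseteq> \<Y> \<and> finite S \<and> S \<noteq> {} \<longrightarrow> \<Inter>S \<in> \<Y>)"

definition Int_closed :: "'z set \<Rightarrow> 'z set set \<Rightarrow> bool" where
  "Int_closed Z \<Y> \<longleftrightarrow> (\<forall>S. S \<subseteq> \<Y> \<longrightarrow> Z \<inter> \<Inter>S \<in> \<Y>)"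

definition choice_fun :: "'z set \<Rightarrow> 'z set set \<Rightarrow> ('z set \<Rightarrow> 'z set) \<Rightarrow> bool" where
  "choice_fun Z \<Y> \<mu> \<longleftrightarrow> \<Y> \<subseteq> Pow Z \<and> \<mu> ` \<Y> \<subseteq> Pow Z \<and> mu_Sub \<Y> \<mu>"

definition pref_choice_fun :: "'z set \<Rightarrow> 'z set set \<Rightarrow> ('z set \<Rightarrow> 'z set) \<Rightarrow> bool" where
  "pref_choice_fun Z \<Y> \<mu> \<longleftrightarrow> choice_fun Z \<Y> \<mu> \<and> mu_PR \<Y> \<mu>"

text \<open>
  Preferential structures with copies: \<open>(p, q) \<in> R\<close> means \<open>p \<prec> q\<close>, and transitivity of the
  structure is \<^term>\<open>trans R\<close>.
\<close>

definition pref_struct :: "('z \<times> 'i) set \<Rightarrow> ('z \<times> 'i) rel \<Rightarrow> bool" where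
  "pref_struct \<U> R \<longleftrightarrow> R \<subseteq> \<U> \<times> \<U>"

definition min_copy :: "('z \<times> 'i) set \<Rightarrow> ('z \<times> 'i) rel \<Rightarrow> 'z set \<Rightarrow> 'z \<times> 'i \<Rightarrow> bool" where
  "min_copy \<U> R X p \<longleftrightarrow> \<not> (\<exists>x' i'. (x', i') \<in> \<U> \<and> x' \<in> X \<and> ((x', i'), p) \<in> R)"

definition pref_mu :: "('z \<times> 'i) set \<Rightarrow> ('z \<times> 'i) rel \<Rightarrow> 'z set \<Rightarrow> 'z set" where
  "pref_mu \<U> R X = {x \<in> X. \<exists>i. (x, i) \<in> \<U> \<and> min_copy \<U> R X (x, i)}"

definition smooth :: "'z set set \<Rightarrow> ('z \<times> 'i) set \<Rightarrow> ('z \<times> 'i) rel \<Rightarrow> bool" where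
  "smooth \<Y> \<U> R \<longleftrightarrow>
    (\<forall>X\<in>\<Y>. \<forall>x\<in>X. \<forall>i. (x, i) \<in> \<U> \<longrightarrow>
      min_copy \<U> R X (x, i) \<or>
      (\<exists>x' i'. (x', i') \<in> \<U> \<and> x' \<in> X \<and> ((x', i'), (x, i)) \<in> R \<and> min_copy \<U> R X (x', i')))"

text \<open>The version without copies.\<close>

definition pref_struct1 :: "'z set \<Rightarrow> 'z rel \<Rightarrow> bool" where
  "pref_struct1 W R \<longleftrightarrow> R \<subseteq> W \<times> W"

definition pref_mu1 :: "'z set \<Rightarrow> 'z rel \<Rightarrow> 'z set \<Rightarrow> 'z set" where
  "pref_mu1 W R X = {x \<in> X \<inter> W. \<not> (\<exists>x' \<in> X \<inter> W. (x', x) \<in> R)}"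

definition smooth1 :: "'z set set \<Rightarrow> 'z set \<Rightarrow> 'z rel \<Rightarrow> bool" where
  "smooth1 \<Y> W R \<longleftrightarrow>
    (\<forall>X\<in>\<Y>. \<forall>x\<in>X. x \<in> pref_mu1 W R X \<or> (\<exists>x' \<in> pref_mu1 W R X. (x', x) \<in> R))"

text \<open>
  The choice functions of preferential structures satisfy the standing assumptions, which
  therefore need not be repeated in validity claims about structures.
\<close>

lemma pref_choice_fun_pref_mu: "\<Y> \<subseteq> Pow Z \<Longrightarrow> pref_choice_fun Z \<Y> (pref_mu \<U> R)"
  unfolding pref_choice_fun_def choice_fun_def mu_Sub_def mu_PR_def pref_mu_def min_copy_def
  by blast

lemma pref_choice_fun_pref_mu1: "\<Y> \<subseteq> Pow Z \<Longrightarrow> pref_choice_fun Z \<Y> (pref_mu1 W R)"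
  unfolding pref_choice_fun_def choice_fun_def mu_Sub_def mu_PR_def pref_mu1_def
  by blast

end

theory Submission
  imports Defs
begin

text \<open>
  The positive claims rest on the following observations.

  Downward, a sequence of length \<open>\<beta>\<close> extends to length \<open>\<alpha>\<close> by repeating its last set.  Hence every
  condition contains its instance at \<open>0\<close>, which says that \<open>\<mu> X \<subseteq> U\<close> implies
  \<open>X \<inter> \<mu> U \<subseteq> \<mu> X\<close>; this gives \<open>(\<mu>PR)\<close> and, with \<open>(\<mu>PR)\<close>, \<open>(\<mu>CUM)\<close>.  Upward, with finite unions,
  induction on \<open>\<beta>\<close> shows \<open>\<mu> (X \<beta> \<union> U) \<subseteq> U\<close>, so \<open>\<mu> (X \<alpha> \<union> U) = \<mu> U\<close>, and \<open>(\<mu>PR)\<close> yields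
  \<open>(\<mu>Cumt \<alpha>)\<close> from \<open>(\<mu>CUM)\<close> alone.  Thus under \<open>(\<union>)\<close> all conditions are equivalent, which is all
  of the upward part, the passage from \<open>(\<mu>Cum \<alpha>)\<close> to \<open>(\<mu>Cumt \<alpha>)\<close>, and both comparisons with
  \<open>(\<mu>CUM)\<close>.

  In a smooth structure, a copy of a point of \<open>\<Inter>\<gamma>\<le>\<alpha>. X \<gamma>\<close> that is minimal in \<open>U\<close> is minimal in each
  \<open>X \<beta>\<close> in turn, because smoothness supplies as a competitor an element of \<open>\<mu> (X \<beta>)\<close>, which lies
  in \<open>U\<close> or an earlier set.  If the point lies in \<open>X \<alpha>\<close> only, transitivity makes the descent
  possible: a competitor from \<open>X \<beta>\<close> is replaced by one from an earlier set.  A structure without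
  copies is a structure in which every point has one copy.

  Two counterexamples serve all the negative claims.  For a non-transitive chain
  \<open>2 \<prec> 1 \<prec> 0\<close>, the pairs \<open>{0, 2}\<close>, \<open>{1, 2}\<close>, \<open>{0, 1}\<close> refute \<open>(\<mu>Cumt \<alpha>)\<close> for \<open>0 < \<alpha>\<close> while
  smoothness keeps every \<open>(\<mu>Cum \<alpha>)\<close> and hence \<open>(\<mu>CUM)\<close>.  To refute \<open>(\<mu>Cum \<alpha>)\<close> while keeping
  \<open>(\<mu>Cumt \<beta>)\<close> for \<open>\<beta> < \<alpha>\<close>, one uses lines \<open>X \<beta>\<close> for \<open>\<beta> \<le> \<alpha>\<close> any two of which, \<open>X \<gamma>\<close> and \<open>X \<delta>\<close> with \<open>\<gamma> < \<delta>\<close>,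
  meet outside a common point in exactly one point, chosen in \<open>X \<delta>\<close> and not in \<open>X \<gamma>\<close>.  For \<open>U\<close>
  without such meeting points, \<open>X \<delta>\<close> can enter a sequence only after all \<open>X \<gamma>\<close> with \<open>\<gamma> < \<delta>\<close>, so
  \<open>X \<alpha>\<close> needs a sequence of length \<open>\<alpha>\<close>.
\<close>

section \<open>Relations between the conditions\<close>

lemma mu_CumD:
  fixes \<alpha> :: "'o::wellorder"
  assumes "mu_Cum \<Y> \<mu> \<alpha>" "U \<in> \<Y>" "\<And>\<gamma>. \<gamma> \<le> \<alpha> \<Longrightarrow> X \<gamma> \<in> \<Y>"
    "\<And>\<beta>. \<beta> \<le> \<alpha> \<Longrightarrow> \<mu> (X \<beta>) \<subseteq> U \<union> (\<Union>\<gamma>\<in>{..<\<beta>}. X \<gamma>)"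
  shows "(\<Inter>\<gamma>\<in>{..\<alpha>}. X \<gamma>) \<inter> \<mu> U \<subseteq> \<mu> (X \<alpha>)"
  using assms unfolding mu_Cum_def by blast

lemma mu_CumtD:
  fixes \<alpha> :: "'o::wellorder"
  assumes "mu_Cumt \<Y> \<mu> \<alpha>" "U \<in> \<Y>" "\<And>\<gamma>. \<gamma> \<le> \<alpha> \<Longrightarrow> X \<gamma> \<in> \<Y>"
    "\<And>\<beta>. \<beta> \<le> \<alpha> \<Longrightarrow> \<mu> (X \<beta>) \<subseteq> U \<union> (\<Union>\<gamma>\<in>{..<\<beta>}. X \<gamma>)"
  shows "X \<alpha> \<inter> \<mu> U \<subseteq> \<mu> (X \<alpha>)"
  using assms unfolding mu_Cumt_def by blast

lemma mu_Cumt_imp_mu_Cum: "mu_Cumt \<Y> \<mu> \<alpha> \<Longrightarrow> mu_Cum \<Y> \<mu> \<alpha>"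
  unfolding mu_Cum_def
proof (intro ballI allI impI)
  fix U X
  assume cumt: "mu_Cumt \<Y> \<mu> \<alpha>" and "U \<in> \<Y>" "\<forall>\<gamma>\<le>\<alpha>. X \<gamma> \<in> \<Y>"
    "\<forall>\<beta>\<le>\<alpha>. \<mu> (X \<beta>) \<subseteq> U \<union> (\<Union>\<gamma>\<in>{..<\<beta>}. X \<gamma>)"
  then have "X \<alpha> \<inter> \<mu> U \<subseteq> \<mu> (X \<alpha>)" by (intro mu_CumtD[OF cumt]) blast+
  then show "(\<Inter>\<gamma>\<in>{..\<alpha>}. X \<gamma>) \<inter> \<mu> U \<subseteq> \<mu> (X \<alpha>)" by auto
qed

text \<open>
  Past \<open>\<beta>\<close> the sequence is continued by \<open>X \<beta>\<close> itself, which costs nothing since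
  \<open>\<mu> (X \<beta>) \<subseteq> X \<beta>\<close>.
\<close>

lemma extended_sequence:
  fixes \<beta> :: "'o::wellorder"
  assumes "mu_Sub \<Y> \<mu>" "X \<beta> \<in> \<Y>"
    and prem: "\<And>\<delta>. \<delta> \<le> \<beta> \<Longrightarrow> \<mu> (X \<delta>) \<subseteq> U \<union> (\<Union>\<gamma>\<in>{..<\<delta>}. X \<gamma>)"
  shows "\<mu> (X (min \<delta> \<beta>)) \<subseteq> U \<union> (\<Union>\<gamma>\<in>{..<\<delta>}. X (min \<gamma> \<beta>))"
proof (cases "\<delta> \<le> \<beta>")
  case True
  have "(\<Union>\<gamma>\<in>{..<\<delta>}. X (min \<gamma> \<beta>)) = (\<Union>\<gamma>\<in>{..<\<delta>}. X \<gamma>)"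
    using True by (intro SUP_cong) (auto simp: min_def)
  then show ?thesis using prem[OF True] True by (simp add: min_def)
next
  case False
  then have "\<mu> (X (min \<delta> \<beta>)) \<subseteq> X (min \<beta> \<beta>)"
    using assms(1,2) by (auto simp: min_def mu_Sub_def)
  moreover have "\<beta> \<in> {..<\<delta>}" using False by simp
  ultimately show ?thesis by blast
qed

lemma mu_Cum_downward:
  fixes \<alpha> \<beta> :: "'o::wellorder"
  assumes "\<beta> \<le> \<alpha>" "mu_Sub \<Y> \<mu>" "mu_Cum \<Y> \<mu> \<alpha>"
  shows "mu_Cum \<Y> \<mu> \<beta>"
  unfolding mu_Cum_def
proof (intro ballI allI impI)
  fix U and X :: "'o \<Rightarrow> _"
  assume U: "U \<in> \<Y>" and X: "\<forall>\<gamma>\<le>\<beta>. X \<gamma> \<in> \<Y>"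
    and prem: "\<forall>\<delta>\<le>\<beta>. \<mu> (X \<delta>) \<subseteq> U \<union> (\<Union>\<gamma>\<in>{..<\<delta>}. X \<gamma>)"
  have "\<mu> (X (min \<delta> \<beta>)) \<subseteq> U \<union> (\<Union>\<gamma>\<in>{..<\<delta>}. X (min \<gamma> \<beta>))" for \<delta>
    using extended_sequence[OF assms(2), of X \<beta> U \<delta>] X prem by blast
  then have "(\<Inter>\<gamma>\<in>{..\<alpha>}. X (min \<gamma> \<beta>)) \<inter> \<mu> U \<subseteq> \<mu> (X (min \<alpha> \<beta>))"
    using X by (intro mu_CumD[OF assms(3) U, of "\<lambda>\<gamma>. X (min \<gamma> \<beta>)"]) auto
  moreover have "(\<Inter>\<gamma>\<in>{..\<beta>}. X \<gamma>) \<subseteq> (\<Inter>\<gamma>\<in>{..\<alpha>}. X (min \<gamma> \<beta>))" by auto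
  ultimately show "(\<Inter>\<gamma>\<in>{..\<beta>}. X \<gamma>) \<inter> \<mu> U \<subseteq> \<mu> (X \<beta>)"
    using assms(1) by (auto simp: min_absorb2)
qed

lemma mu_Cumt_downward:
  fixes \<alpha> \<beta> :: "'o::wellorder"
  assumes "\<beta> \<le> \<alpha>" "mu_Sub \<Y> \<mu>" "mu_Cumt \<Y> \<mu> \<alpha>"
  shows "mu_Cumt \<Y> \<mu> \<beta>"
  unfolding mu_Cumt_def
proof (intro ballI allI impI)
  fix U and X :: "'o \<Rightarrow> _"
  assume U: "U \<in> \<Y>" and X: "\<forall>\<gamma>\<le>\<beta>. X \<gamma> \<in> \<Y>"
    and prem: "\<forall>\<delta>\<le>\<beta>. \<mu> (X \<delta>) \<subseteq> U \<union> (\<Union>\<gamma>\<in>{..<\<delta>}. X \<gamma>)"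
  have "\<mu> (X (min \<delta> \<beta>)) \<subseteq> U \<union> (\<Union>\<gamma>\<in>{..<\<delta>}. X (min \<gamma> \<beta>))" for \<delta>
    using extended_sequence[OF assms(2), of X \<beta> U \<delta>] X prem by blast
  then have "X (min \<alpha> \<beta>) \<inter> \<mu> U \<subseteq> \<mu> (X (min \<alpha> \<beta>))"
    using X by (intro mu_CumtD[OF assms(3) U, of "\<lambda>\<gamma>. X (min \<gamma> \<beta>)"]) auto
  then show "X \<beta> \<inter> \<mu> U \<subseteq> \<mu> (X \<beta>)"
    using assms(1) by (simp add: min_absorb2)
qed

lemma le_ord_zero_iff: "\<gamma> \<le> ord_zero \<longleftrightarrow> \<gamma> = (ord_zero :: 'o::wellorder)"
  using ord_zero_le[of \<gamma>] by (auto intro: antisym)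

lemma not_less_ord_zero: "\<not> \<gamma> < (ord_zero :: 'o::wellorder)"
  using ord_zero_le[of \<gamma>] by (simp add: not_less)

lemma mu_Cum_zero_iff:
  "mu_Cum \<Y> \<mu> (ord_zero :: 'o::wellorder) \<longleftrightarrow>
    (\<forall>U\<in>\<Y>. \<forall>X\<in>\<Y>. \<mu> X \<subseteq> U \<longrightarrow> X \<inter> \<mu> U \<subseteq> \<mu> X)" (is "_ \<longleftrightarrow> ?R")
proof
  assume cum: "mu_Cum \<Y> \<mu> (ord_zero :: 'o)"
  show ?R
  proof (intro ballI impI)
    fix U X assume "U \<in> \<Y>" "X \<in> \<Y>" "\<mu> X \<subseteq> U"
    then have "(\<Inter>\<gamma>\<in>{..ord_zero :: 'o}. X) \<inter> \<mu> U \<subseteq> \<mu> X"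
      by (intro mu_CumD[OF cum]) auto
    then show "X \<inter> \<mu> U \<subseteq> \<mu> X" by auto
  qed
next
  assume ?R
  moreover have "{..<ord_zero :: 'o} = {}" "{..ord_zero :: 'o} = {ord_zero}"
    by (auto simp: le_ord_zero_iff not_less_ord_zero)
  ultimately show "mu_Cum \<Y> \<mu> (ord_zero :: 'o)"
    unfolding mu_Cum_def by (simp add: le_ord_zero_iff)
qed

lemma mu_Cum_zero_imp_mu_PR:
  assumes "mu_Sub \<Y> \<mu>" "mu_Cum \<Y> \<mu> (ord_zero :: 'o::wellorder)"
  shows "mu_PR \<Y> \<mu>"
  unfolding mu_PR_def
proof (intro ballI impI)
  fix X Y assume "X \<in> \<Y>" "Y \<in> \<Y>" "X \<subseteq> Y"
  moreover from this have "\<mu> X \<subseteq> Y" using assms(1) by (auto simp: mu_Sub_def)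
  ultimately have "X \<inter> \<mu> Y \<subseteq> \<mu> X"
    using assms(2) unfolding mu_Cum_zero_iff by blast
  then show "\<mu> Y \<inter> X \<subseteq> \<mu> X" by blast
qed

lemma mu_Cum_imp_mu_CUM:
  fixes \<alpha> :: "'o::wellorder"
  assumes sub: "mu_Sub \<Y> \<mu>" and "mu_Cum \<Y> \<mu> \<alpha>"
  shows "mu_CUM \<Y> \<mu>"
proof -
  have zero: "mu_Cum \<Y> \<mu> (ord_zero :: 'o)"
    using mu_Cum_downward[OF ord_zero_le assms] .
  have pr: "mu_PR \<Y> \<mu>" using mu_Cum_zero_imp_mu_PR[OF sub zero] .
  show ?thesis
    unfolding mu_CUM_def
  proof (intro ballI impI)
    fix X Y assume *: "X \<in> \<Y>" "Y \<in> \<Y>" "\<mu> X \<subseteq> Y \<and> Y \<subseteq> X"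
    have "\<mu> Y \<subseteq> Y" using sub * by (auto simp: mu_Sub_def)
    moreover have "X \<inter> \<mu> Y \<subseteq> \<mu> X" using zero * unfolding mu_Cum_zero_iff by blast
    moreover have "\<mu> X \<inter> Y \<subseteq> \<mu> Y" using pr * unfolding mu_PR_def by blast
    ultimately show "\<mu> X = \<mu> Y" using * by blast
  qed
qed

lemma pref_choice_fun_mu_Sub: "pref_choice_fun Z \<Y> \<mu> \<Longrightarrow> mu_Sub \<Y> \<mu>"
  by (simp add: pref_choice_fun_def choice_fun_def)

lemma pref_choice_fun_mu_PR: "pref_choice_fun Z \<Y> \<mu> \<Longrightarrow> mu_PR \<Y> \<mu>"
  by (simp add: pref_choice_fun_def)

lemma pref_mu_Cum_imp_mu_CUM:
  "pref_choice_fun Z \<Y> \<mu> \<Longrightarrow> mu_Cum \<Y> \<mu> (\<alpha> :: 'o::wellorder) \<Longrightarrow> mu_CUM \<Y> \<mu>"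
  using mu_Cum_imp_mu_CUM[OF pref_choice_fun_mu_Sub] .

lemma mu_CUM_Int_imp_mu_Cum_zero:
  assumes pr: "mu_PR \<Y> \<mu>" and sub: "mu_Sub \<Y> \<mu>" and cum: "mu_CUM \<Y> \<mu>"
    and int: "\<And>A B. A \<in> \<Y> \<Longrightarrow> B \<in> \<Y> \<Longrightarrow> A \<inter> B \<in> \<Y>"
  shows "mu_Cum \<Y> \<mu> (ord_zero :: 'o::wellorder)"
  unfolding mu_Cum_zero_iff
proof (intro ballI impI)
  fix U X assume *: "U \<in> \<Y>" "X \<in> \<Y>" "\<mu> X \<subseteq> U"
  have "\<mu> X \<subseteq> X \<inter> U" using * sub by (auto simp: mu_Sub_def)
  then have "\<mu> X = \<mu> (X \<inter> U)"
    using cum[unfolded mu_CUM_def, rule_format, of X "X \<inter> U"] * int by blast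
  moreover have "\<mu> U \<inter> (X \<inter> U) \<subseteq> \<mu> (X \<inter> U)"
    using pr[unfolded mu_PR_def, rule_format, of "X \<inter> U" U] * int by blast
  moreover have "\<mu> U \<subseteq> U" using * sub by (auto simp: mu_Sub_def)
  ultimately show "X \<inter> \<mu> U \<subseteq> \<mu> X" by blast
qed

section \<open>Closure under finite unions\<close>

locale cumulative_Un =
  fixes \<Y> :: "'z set set" and \<mu> :: "'z set \<Rightarrow> 'z set"
  assumes sub: "X \<in> \<Y> \<Longrightarrow> \<mu> X \<subseteq> X"
    and pr: "X \<in> \<Y> \<Longrightarrow> Y \<in> \<Y> \<Longrightarrow> X \<subseteq> Y \<Longrightarrow> \<mu> Y \<inter> X \<subseteq> \<mu> X"
    and cum: "X \<in> \<Y> \<Longrightarrow> Y \<in> \<Y> \<Longrightarrow> \<mu> X \<subseteq> Y \<Longrightarrow> Y \<subseteq> X \<Longrightarrow> \<mu> X = \<mu> Y"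
    and Un: "X \<in> \<Y> \<Longrightarrow> Y \<in> \<Y> \<Longrightarrow> X \<union> Y \<in> \<Y>"
begin

lemma mu_Un_absorb:
  assumes "A \<in> \<Y>" "B \<in> \<Y>" "\<mu> A \<subseteq> B"
  shows "\<mu> (A \<union> B) = \<mu> B"
proof (rule cum)
  have "\<mu> (A \<union> B) \<inter> A \<subseteq> \<mu> A" using assms by (intro pr Un) auto
  then show "\<mu> (A \<union> B) \<subseteq> B" using sub[OF Un[OF assms(1,2)]] assms(3) by blast
qed (use assms Un in auto)

lemma mu_Un_absorb_between:
  assumes "X \<in> \<Y>" "Y \<in> \<Y>" "\<mu> X \<subseteq> U" "U \<subseteq> Y"
  shows "\<mu> (Y \<union> X) = \<mu> Y"
  using mu_Un_absorb[of X Y] assms by (simp add: Un_commute)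

lemma mu_Int_subset_between:
  assumes "X \<in> \<Y>" "Y \<in> \<Y>" "U \<in> \<Y>" "\<mu> X \<subseteq> U" "U \<subseteq> Y"
  shows "\<mu> Y \<inter> X \<subseteq> \<mu> U"
proof -
  have "\<mu> (Y \<union> X) \<inter> X \<subseteq> \<mu> X" and "\<mu> (Y \<union> X) \<inter> U \<subseteq> \<mu> U"
    using assms by (intro pr Un; blast)+
  then show ?thesis
    using assms(4) mu_Un_absorb_between[OF assms(1,2,4,5)] by blast
qed

text \<open>
  The invariant \<open>\<mu> (X \<beta> \<union> U) \<subseteq> U\<close> involves a union of two sets only, whatever the length of
  the sequence; this is why finite unions suffice for all ordinals.
\<close>

lemma mu_Un_subset:
  fixes X :: "'o::wellorder \<Rightarrow> 'z set"
  assumes U: "U \<in> \<Y>" and X: "\<And>\<gamma>. \<gamma> \<le> \<alpha> \<Longrightarrow> X \<gamma> \<in> \<Y>"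
    and prem: "\<And>\<beta>. \<beta> \<le> \<alpha> \<Longrightarrow> \<mu> (X \<beta>) \<subseteq> U \<union> (\<Union>\<gamma>\<in>{..<\<beta>}. X \<gamma>)"
  shows "\<beta> \<le> \<alpha> \<Longrightarrow> \<mu> (X \<beta> \<union> U) \<subseteq> U"
proof (induction \<beta> rule: less_induct)
  case (less \<beta>)
  have XU: "X \<gamma> \<union> U \<in> \<Y>" if "\<gamma> \<le> \<beta>" for \<gamma>
    using Un U X less.prems that by (meson order_trans)
  show ?case
  proof (rule subsetI, rule ccontr)
    fix x assume x: "x \<in> \<mu> (X \<beta> \<union> U)" "x \<notin> U"
    then have "x \<in> X \<beta>" using sub[OF XU[OF order_refl]] by blast
    with x have "x \<in> \<mu> (X \<beta>)"
      using pr[of "X \<beta>" "X \<beta> \<union> U"] X[OF less.prems] XU[OF order_refl] by blast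
    with x prem[OF less.prems] obtain \<gamma> where \<gamma>: "\<gamma> < \<beta>" "x \<in> X \<gamma>" by blast
    have "\<mu> (X \<gamma> \<union> U) \<subseteq> U" using less \<gamma> by simp
    then have "\<mu> (X \<beta> \<union> U) \<inter> (X \<gamma> \<union> U) \<subseteq> \<mu> U"
      using \<gamma> U by (intro mu_Int_subset_between XU) auto
    with x \<gamma> sub[OF U] show False by blast
  qed
qed

lemma mu_Cumt: "mu_Cumt \<Y> \<mu> (\<alpha> :: 'o::wellorder)"
  unfolding mu_Cumt_def
proof (intro ballI allI impI)
  fix U and X :: "'o \<Rightarrow> _"
  assume U: "U \<in> \<Y>" and X: "\<forall>\<gamma>\<le>\<alpha>. X \<gamma> \<in> \<Y>"
    and prem: "\<forall>\<beta>\<le>\<alpha>. \<mu> (X \<beta>) \<subseteq> U \<union> (\<Union>\<gamma>\<in>{..<\<beta>}. X \<gamma>)"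
  have XU: "X \<alpha> \<union> U \<in> \<Y>" using U X by (simp add: Un)
  have "\<mu> (X \<alpha> \<union> U) \<subseteq> U"
    using X prem by (intro mu_Un_subset[OF U, of \<alpha>]) auto
  then have "\<mu> (X \<alpha> \<union> U) = \<mu> U" using XU U by (intro cum) auto
  then show "X \<alpha> \<inter> \<mu> U \<subseteq> \<mu> (X \<alpha>)"
    using pr[of "X \<alpha>" "X \<alpha> \<union> U"] XU X by blast
qed

end

lemma cumulative_UnI:
  assumes "pref_choice_fun Z \<Y> \<mu>" "mu_CUM \<Y> \<mu>" "fin_Un_closed \<Y>"
  shows "cumulative_Un \<Y> \<mu>"
proof -
  note pref_choice_fun_mu_Sub[OF assms(1), unfolded mu_Sub_def, rule_format]
    and pref_choice_fun_mu_PR[OF assms(1), unfolded mu_PR_def, rule_format]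
    and assms(2)[unfolded mu_CUM_def, rule_format, OF _ _ conjI]
  moreover have "X \<union> Y \<in> \<Y>" if "X \<in> \<Y>" "Y \<in> \<Y>" for X Y
    using that assms(3)[unfolded fin_Un_closed_def, rule_format, of "{X, Y}"] by simp
  ultimately show ?thesis by (rule cumulative_Un.intro)
qed

lemma mu_CUM_Un_imp_mu_Cumt:
  "pref_choice_fun Z \<Y> \<mu> \<Longrightarrow> mu_CUM \<Y> \<mu> \<Longrightarrow> fin_Un_closed \<Y> \<Longrightarrow>
    mu_Cumt \<Y> \<mu> (\<alpha> :: 'o::wellorder)"
  using cumulative_Un.mu_Cumt[OF cumulative_UnI] .

section \<open>Smooth structures\<close>

lemma mu_Cum_smooth:
  assumes smooth: "smooth \<Y> \<U> R"
  shows "mu_Cum \<Y> (pref_mu \<U> R) (\<alpha> :: 'o::wellorder)"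
  unfolding mu_Cum_def
proof (intro ballI allI impI subsetI)
  fix U and X :: "'o \<Rightarrow> _" and x
  assume X: "\<forall>\<gamma>\<le>\<alpha>. X \<gamma> \<in> \<Y>"
    and prem: "\<forall>\<beta>\<le>\<alpha>. pref_mu \<U> R (X \<beta>) \<subseteq> U \<union> (\<Union>\<gamma>\<in>{..<\<beta>}. X \<gamma>)"
    and x: "x \<in> (\<Inter>\<gamma>\<in>{..\<alpha>}. X \<gamma>) \<inter> pref_mu \<U> R U"
  then obtain i where i: "(x, i) \<in> \<U>" "min_copy \<U> R U (x, i)"
    by (auto simp: pref_mu_def)
  have "min_copy \<U> R (X \<beta>) (x, i)" if "\<beta> \<le> \<alpha>" for \<beta>
    using that
  proof (induction \<beta> rule: less_induct)
    case (less \<beta>)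
    show ?case
    proof (rule ccontr)
      assume "\<not> min_copy \<U> R (X \<beta>) (x, i)"
      moreover have "X \<beta> \<in> \<Y>" "x \<in> X \<beta>" using X x less.prems by auto
      ultimately obtain x' i' where *: "(x', i') \<in> \<U>" "x' \<in> X \<beta>"
        "((x', i'), (x, i)) \<in> R" "min_copy \<U> R (X \<beta>) (x', i')"
        using smooth i(1) unfolding smooth_def by blast
      then have "x' \<in> pref_mu \<U> R (X \<beta>)" by (auto simp: pref_mu_def)
      with prem less.prems consider "x' \<in> U" | \<gamma> where "\<gamma> < \<beta>" "x' \<in> X \<gamma>" by blast
      then show False
      proof cases
        case 1
        then show False using i(2) * unfolding min_copy_def by blast
      next
        case 2
        then have "min_copy \<U> R (X \<gamma>) (x, i)" using less by simp
        then show False using 2 * unfolding min_copy_def by blast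
      qed
    qed
  qed
  then show "x \<in> pref_mu \<U> R (X \<alpha>)" using i x by (auto simp: pref_mu_def)
qed

lemma mu_Cumt_smooth_trans:
  assumes smooth: "smooth \<Y> \<U> R" and trans: "trans R"
  shows "mu_Cumt \<Y> (pref_mu \<U> R) (\<alpha> :: 'o::wellorder)"
  unfolding mu_Cumt_def
proof (intro ballI allI impI subsetI)
  fix U and X :: "'o \<Rightarrow> _" and x
  assume X: "\<forall>\<gamma>\<le>\<alpha>. X \<gamma> \<in> \<Y>"
    and prem: "\<forall>\<beta>\<le>\<alpha>. pref_mu \<U> R (X \<beta>) \<subseteq> U \<union> (\<Union>\<gamma>\<in>{..<\<beta>}. X \<gamma>)"
    and x: "x \<in> X \<alpha> \<inter> pref_mu \<U> R U"
  then obtain i where i: "(x, i) \<in> \<U>" "min_copy \<U> R U (x, i)"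
    by (auto simp: pref_mu_def)
  have "min_copy \<U> R (X \<beta>) (x, i)" if "\<beta> \<le> \<alpha>" for \<beta>
    using that
  proof (induction \<beta> rule: less_induct)
    case (less \<beta>)
    show ?case
    proof (rule ccontr)
      assume "\<not> min_copy \<U> R (X \<beta>) (x, i)"
      then obtain y j where y: "(y, j) \<in> \<U>" "y \<in> X \<beta>" "((y, j), (x, i)) \<in> R"
        unfolding min_copy_def by blast
      \<comment> \<open>Here \<open>x\<close> need not lie in \<open>X \<beta>\<close>, so smoothness is applied to the competitor \<open>y\<close>
        and the result is carried back to \<open>x\<close> by transitivity.\<close>
      have "X \<beta> \<in> \<Y>" using X less.prems by blast
      then obtain x' i' where *: "(x', i') \<in> \<U>" "x' \<in> X \<beta>"
        "((x', i'), (x, i)) \<in> R" "min_copy \<U> R (X \<beta>) (x', i')"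
        using smooth y trans unfolding smooth_def trans_def by meson
      then have "x' \<in> pref_mu \<U> R (X \<beta>)" by (auto simp: pref_mu_def)
      with prem less.prems consider "x' \<in> U" | \<gamma> where "\<gamma> < \<beta>" "x' \<in> X \<gamma>" by blast
      then show False
      proof cases
        case 1
        then show False using i(2) * unfolding min_copy_def by blast
      next
        case 2
        then have "min_copy \<U> R (X \<gamma>) (x, i)" using less by simp
        then show False using 2 * unfolding min_copy_def by blast
      qed
    qed
  qed
  then show "x \<in> pref_mu \<U> R (X \<alpha>)" using i x by (auto simp: pref_mu_def)
qed

text \<open>A structure without copies amounts to one in which every point has the single index \<open>c\<close>.\<close>

definition one_copy :: "'i \<Rightarrow> 'z rel \<Rightarrow> ('z \<times> 'i) rel" where
  "one_copy c R = {((x, c), (y, c)) | x y. (x, y) \<in> R}"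

lemma one_copy_iff: "((x, i), (y, j)) \<in> one_copy c R \<longleftrightarrow> i = c \<and> j = c \<and> (x, y) \<in> R"
  unfolding one_copy_def by blast

lemma min_copy_one_copy:
  "min_copy (W \<times> {c}) (one_copy c R) X (x, c) \<longleftrightarrow> \<not> (\<exists>x'\<in>X \<inter> W. (x', x) \<in> R)"
  unfolding min_copy_def one_copy_iff by auto

lemma pref_mu_one_copy: "pref_mu (W \<times> {c}) (one_copy c R) = pref_mu1 W R"
  by (intro ext) (auto simp: pref_mu_def pref_mu1_def min_copy_one_copy)

lemma smooth_one_copy:
  assumes "smooth1 \<Y> W R"
  shows "smooth \<Y> (W \<times> {c}) (one_copy c R)"
  unfolding smooth_def
proof (intro ballI allI impI)
  fix X x i assume X: "X \<in> \<Y>" "x \<in> X" and "(x, i) \<in> W \<times> {c}"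
  then have i: "i = c" by simp
  have "x \<in> pref_mu1 W R X \<or> (\<exists>x'\<in>pref_mu1 W R X. (x', x) \<in> R)"
    using assms X unfolding smooth1_def by blast
  then show "min_copy (W \<times> {c}) (one_copy c R) X (x, i) \<or>
      (\<exists>x' i'. (x', i') \<in> W \<times> {c} \<and> x' \<in> X \<and> ((x', i'), (x, i)) \<in> one_copy c R \<and>
        min_copy (W \<times> {c}) (one_copy c R) X (x', i'))"
  proof
    assume "x \<in> pref_mu1 W R X"
    then show ?thesis unfolding i min_copy_one_copy pref_mu1_def by blast
  next
    assume "\<exists>x'\<in>pref_mu1 W R X. (x', x) \<in> R"
    then obtain x' where x': "x' \<in> X" "x' \<in> W" "(x', x) \<in> R" "\<not> (\<exists>z\<in>X \<inter> W. (z, x') \<in> R)"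
      unfolding pref_mu1_def by blast
    then have "(x', c) \<in> W \<times> {c} \<and> x' \<in> X \<and> ((x', c), (x, i)) \<in> one_copy c R \<and>
        min_copy (W \<times> {c}) (one_copy c R) X (x', c)"
      unfolding i min_copy_one_copy one_copy_iff by blast
    then show ?thesis by blast
  qed
qed

lemma pref_struct_one_copy: "pref_struct1 W R \<Longrightarrow> pref_struct (W \<times> {c}) (one_copy c R)"
  unfolding pref_struct1_def pref_struct_def one_copy_def by auto

lemma trans_one_copy: "trans R \<Longrightarrow> trans (one_copy c R)"
  unfolding trans_def one_copy_def by blast

lemma mu_Cum_smooth1:
  "smooth1 \<Y> W R \<Longrightarrow> mu_Cum \<Y> (pref_mu1 W R) (\<alpha> :: 'o::wellorder)"
  using mu_Cum_smooth[OF smooth_one_copy, of \<Y> W R "()" \<alpha>] by (simp add: pref_mu_one_copy)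

lemma mu_Cumt_smooth1_trans:
  "smooth1 \<Y> W R \<Longrightarrow> trans R \<Longrightarrow> mu_Cumt \<Y> (pref_mu1 W R) (\<alpha> :: 'o::wellorder)"
  using mu_Cumt_smooth_trans[OF smooth_one_copy trans_one_copy, of \<Y> W R "()" \<alpha>]
  by (simp add: pref_mu_one_copy)

section \<open>A smooth structure that is not transitive\<close>

text \<open>
  The chain \<open>2 \<prec> 1 \<prec> 0\<close> with \<open>2\<close> and \<open>0\<close> unrelated is not smooth on \<open>{0, 1, 2}\<close>, which is
  therefore left out of the family.  As closure under intersections puts the whole space into
  the family, a point \<open>3\<close> below all others is added to make the structure smooth there.
\<close>

definition chain_rel :: "nat rel" where
  "chain_rel = {(1, 0), (2, 1), (3, 0), (3, 1), (3, 2)}"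

definition chain_family :: "nat set set" where
  "chain_family = insert {0, 1, 2, 3} {S. S \<subset> {0, 1, 2}}"

lemma chain_familyE [consumes 1]:
  assumes "X \<in> chain_family"
  obtains "X = {0, 1, 2, 3}" | "X \<subset> {0, 1, 2}"
  using assms unfolding chain_family_def insert_iff mem_Collect_eq by (elim disjE)

lemma chain_familyI: "X \<subseteq> {0, 1, 2} \<Longrightarrow> \<not> {0, 1, 2} \<subseteq> X \<Longrightarrow> X \<in> chain_family"
  unfolding chain_family_def insert_iff mem_Collect_eq less_le_not_le by (intro disjI2 conjI)

lemma pref_struct_chain: "pref_struct1 {0, 1, 2, 3} chain_rel"
  unfolding pref_struct1_def chain_rel_def by auto

lemma chain_rel_iff: "(x, y) \<in> chain_rel \<longleftrightarrow> x = 1 \<and> y = 0 \<or> x = 2 \<and> y = 1 \<or> x = 3 \<and> y < 3"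
  unfolding chain_rel_def by (auto simp: numeral_3_eq_3 less_Suc_eq)

lemma pref_mu1_chain:
  assumes "X \<subset> {0, 1, 2}"
  shows "x \<in> pref_mu1 {0, 1, 2, 3} chain_rel X \<longleftrightarrow>
    x \<in> X \<and> \<not> (x = 0 \<and> 1 \<in> X) \<and> \<not> (x = 1 \<and> 2 \<in> X)"
proof -
  have W: "X \<inter> {0, 1, 2, 3} = X" and "3 \<notin> X" using psubset_imp_subset[OF assms] by auto
  then show ?thesis unfolding pref_mu1_def W chain_rel_iff by blast
qed

lemma smooth_chain: "smooth1 chain_family {0, 1, 2, 3} chain_rel"
  unfolding smooth1_def
proof (intro ballI)
  fix X x assume "X \<in> chain_family" and x: "x \<in> X"
  then show "x \<in> pref_mu1 {0, 1, 2, 3} chain_rel X \<or>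
      (\<exists>x'\<in>pref_mu1 {0, 1, 2, 3} chain_rel X. (x', x) \<in> chain_rel)"
  proof (cases rule: chain_familyE)
    case X: 1
    have "3 \<in> pref_mu1 {0, 1, 2, 3} chain_rel X"
      unfolding X pref_mu1_def chain_rel_iff by auto
    moreover have "x = 3 \<or> x < 3" using x unfolding X by auto
    ultimately show ?thesis unfolding chain_rel_iff by blast
  next
    case X: 2
    have "\<not> (0 \<in> X \<and> 1 \<in> X \<and> 2 \<in> X)" using X by blast
    moreover have "x \<in> pref_mu1 {0, 1, 2, 3} chain_rel X \<or> x = 0 \<and> 1 \<in> X \<or> x = 1 \<and> 2 \<in> X"
      using x pref_mu1_chain[OF X, of x] by blast
    ultimately consider "x \<in> pref_mu1 {0, 1, 2, 3} chain_rel X"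
      | "x = 0" "1 \<in> X" "2 \<notin> X" | "x = 1" "2 \<in> X" using x by blast
    then show ?thesis
    proof cases
      case 1
      then show ?thesis ..
    next
      case 2
      then have "1 \<in> pref_mu1 {0, 1, 2, 3} chain_rel X" by (subst pref_mu1_chain[OF X]) simp
      then show ?thesis using 2(1) unfolding chain_rel_iff by blast
    next
      case 3
      then have "2 \<in> pref_mu1 {0, 1, 2, 3} chain_rel X" by (subst pref_mu1_chain[OF X]) simp
      then show ?thesis using 3(1) unfolding chain_rel_iff by blast
    qed
  qed
qed

lemma Int_closed_chain: "Int_closed {0, 1, 2, 3} chain_family"
  unfolding Int_closed_def
proof (intro allI impI)
  fix S assume S: "S \<subseteq> chain_family"
  show "{0, 1, 2, 3} \<inter> \<Inter>S \<in> chain_family"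
  proof (cases "S \<subseteq> {{0, 1, 2, 3}}")
    case True
    then have "{0, 1, 2, 3} \<inter> \<Inter>S = {0, 1, 2, 3}" by auto
    then show ?thesis by (simp add: chain_family_def)
  next
    case False
    then obtain A where A: "A \<in> S" "A \<noteq> {0, 1, 2, 3}" by blast
    from A(1) S have "A \<in> chain_family" by blast
    then have "A \<subset> {0, 1, 2}" using A(2) chain_familyE by metis
    moreover have "{0, 1, 2, 3} \<inter> \<Inter>S \<subseteq> A" using A(1) by blast
    ultimately have "{0, 1, 2, 3} \<inter> \<Inter>S \<subset> {0, 1, 2}" by (rule subset_psubset_trans[rotated])
    then show ?thesis by (simp add: chain_family_def)
  qed
qed

lemma pref_choice_fun_chain:
  "pref_choice_fun {0, 1, 2, 3} chain_family (pref_mu1 {0, 1, 2, 3} chain_rel)"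
  by (rule pref_choice_fun_pref_mu1) (auto simp: chain_family_def)

lemma mu_CUM_chain: "mu_CUM chain_family (pref_mu1 {0, 1, 2, 3} chain_rel)"
  using pref_mu_Cum_imp_mu_CUM[OF pref_choice_fun_chain mu_Cum_smooth1[OF smooth_chain, of "0 :: nat"]] .

lemma not_mu_Cumt_chain:
  assumes "ord_zero < (\<alpha> :: 'o::wellorder)"
  shows "\<not> mu_Cumt chain_family (pref_mu1 {0, 1, 2, 3} chain_rel) \<alpha>"
proof
  let ?\<mu> = "pref_mu1 {0, 1, 2, 3} chain_rel"
  let ?X = "\<lambda>\<gamma>::'o. if \<gamma> = ord_zero then {1, 2} else {0, 1 :: nat}"
  have \<mu>: "?\<mu> {1, 2} = {2}" "?\<mu> {0, 1} = {1}" "?\<mu> {0, 2} = {0, 2}"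
    by (auto simp: pref_mu1_def chain_rel_def)
  assume "mu_Cumt chain_family ?\<mu> \<alpha>"
  then have "?X \<alpha> \<inter> ?\<mu> {0, 2} \<subseteq> ?\<mu> (?X \<alpha>)"
  proof (rule mu_CumtD[where X = ?X])
    fix \<beta> :: 'o
    show "?\<mu> (?X \<beta>) \<subseteq> {0, 2} \<union> (\<Union>\<gamma>\<in>{..<\<beta>}. ?X \<gamma>)"
    proof (cases "\<beta> = ord_zero")
      case False
      then have "ord_zero \<in> {..<\<beta>}" 
        by (metis lessThan_iff ord_zero_le order.not_eq_order_implies_strict)
      then have "?X ord_zero \<subseteq> (\<Union>\<gamma>\<in>{..<\<beta>}. ?X \<gamma>)" by blast
      then show ?thesis using False \<mu> by auto
    qed (use \<mu> in simp)
  qed (simp_all add: chain_familyI)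
  moreover have "?X \<alpha> = {0, 1}" using less_imp_neq[OF assms] by simp
  ultimately have "{0, 1} \<inter> ?\<mu> {0, 2} \<subseteq> ?\<mu> {0, 1}" by (simp only:)
  then show False unfolding \<mu> by simp
qed

section \<open>Failure at a given ordinal only\<close>

text \<open>
  \<open>Inr 0\<close> is the point common to all sets of the family.  For \<open>\<gamma> < \<delta>\<close>, \<open>Inl (\<gamma>, \<delta>)\<close> is the point
  in which the lines of \<open>\<gamma>\<close> and \<open>\<delta>\<close> meet, and \<open>Inl (\<gamma>, \<gamma>)\<close> the one in which the line of \<open>\<gamma>\<close> meets
  the diagonal; the latter tags its line.  The diagonal plays the part of \<open>U\<close>.
\<close>

definition line :: "'o::wellorder \<Rightarrow> 'o \<Rightarrow> ('o \<times> 'o + nat) set" where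
  "line \<alpha> \<beta> = insert (Inr 0) {Inl (\<gamma>, \<delta>) | \<gamma> \<delta>. \<gamma> \<le> \<delta> \<and> \<delta> \<le> \<alpha> \<and> (\<gamma> = \<beta> \<or> \<delta> = \<beta>)}"

definition diagonal :: "'o::wellorder \<Rightarrow> ('o \<times> 'o + nat) set" where
  "diagonal \<alpha> = insert (Inr 0) {Inl (\<gamma>, \<gamma>) | \<gamma>. \<gamma> \<le> \<alpha>}"

text \<open>
  \<open>Inr 1\<close> lies in the whole space only.  There it is the only point chosen, which keeps the
  whole space, required by closure under intersections, apart from the rest of the family.
\<close>

definition line_space :: "'o::wellorder \<Rightarrow> ('o \<times> 'o + nat) set" where
  "line_space \<alpha> = {Inr 0, Inr 1} \<union> {Inl (\<gamma>, \<delta>) | \<gamma> \<delta>. \<gamma> \<le> \<delta> \<and> \<delta> \<le> \<alpha>}"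

definition proper_family :: "'o::wellorder \<Rightarrow> ('o \<times> 'o + nat) set set" where
  "proper_family \<alpha> = {diagonal \<alpha>} \<union> line \<alpha> ` {..\<alpha>} \<union> {{Inr 0}} \<union>
     {{Inr 0, Inl (\<gamma>, \<delta>)} | \<gamma> \<delta>. \<gamma> \<le> \<delta> \<and> \<delta> \<le> \<alpha>}"

definition line_family :: "'o::wellorder \<Rightarrow> ('o \<times> 'o + nat) set set" where
  "line_family \<alpha> = insert (line_space \<alpha>) (proper_family \<alpha>)"

text \<open>
  Of two lines, only the later one has their meeting point among its chosen points.  Leaving the
  common point out of the last line is what makes \<open>(\<mu>Cum \<alpha>)\<close> fail.
\<close>

definition line_mu :: "'o::wellorder \<Rightarrow> ('o \<times> 'o + nat) set \<Rightarrow> ('o \<times> 'o + nat) set" where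
  "line_mu \<alpha> S = (if Inr 1 \<in> S then {Inr 1} else
     {p \<in> S. \<not> (p = Inr 0 \<and> S = line \<alpha> \<alpha>) \<and>
       \<not> (\<exists>\<gamma> \<delta>. p = Inl (\<gamma>, \<delta>) \<and> \<gamma> < \<delta> \<and> S = line \<alpha> \<gamma>)})"

lemma proper_familyE [consumes 1]:
  assumes "S \<in> proper_family \<alpha>"
  obtains "S = diagonal \<alpha>" | \<beta> where "\<beta> \<le> \<alpha>" "S = line \<alpha> \<beta>" | "S = {Inr 0}"
    | \<gamma> \<delta> where "\<gamma> \<le> \<delta>" "\<delta> \<le> \<alpha>" "S = {Inr 0, Inl (\<gamma>, \<delta>)}"
  using assms unfolding proper_family_def by blast

lemma proper_family_points:
  assumes "S \<in> proper_family \<alpha>"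
  shows "Inr 0 \<in> S" "Inr 1 \<notin> S" "S \<subseteq> line_space \<alpha>"
  using assms by (cases rule: proper_familyE; auto simp: diagonal_def line_def line_space_def)+

lemma line_eq_iff: "\<beta> \<le> \<alpha> \<Longrightarrow> line \<alpha> \<beta> = line \<alpha> \<gamma> \<longleftrightarrow> \<beta> = \<gamma>"
  unfolding line_def by blast

lemma tag_in_line: "\<beta> \<le> \<alpha> \<Longrightarrow> Inl (\<beta>, \<beta>) \<in> line \<alpha> \<beta>"
  unfolding line_def by blast

lemma meet_in_line:
  "\<gamma> \<le> \<delta> \<Longrightarrow> \<delta> \<le> \<alpha> \<Longrightarrow> Inl (\<gamma>, \<delta>) \<in> line \<alpha> \<gamma>"
  "\<gamma> \<le> \<delta> \<Longrightarrow> \<delta> \<le> \<alpha> \<Longrightarrow> Inl (\<gamma>, \<delta>) \<in> line \<alpha> \<delta>"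
  unfolding line_def by blast+

lemma line_mu_subset: "line_mu \<alpha> S \<subseteq> S"
  unfolding line_mu_def by auto

lemma two_points_line:
  assumes "S \<in> proper_family \<alpha>" "Inl (\<gamma>, \<gamma>) \<in> S" "Inl (\<gamma>, \<delta>) \<in> S" "\<gamma> < \<delta>"
  shows "S = line \<alpha> \<gamma>"
  using assms by (cases rule: proper_familyE) (auto simp: diagonal_def line_def)

lemma proper_family_meet:
  assumes "A \<in> proper_family \<alpha>" "B \<in> proper_family \<alpha>" "A \<noteq> B"
  obtains p where "A \<inter> B \<subseteq> {Inr 0, p}"
proof -
  have lines: "line \<alpha> \<beta> \<inter> line \<alpha> \<gamma> \<subseteq> {Inr 0, Inl (min \<beta> \<gamma>, max \<beta> \<gamma>)}" if "\<beta> \<noteq> \<gamma>" for \<beta> \<gamma>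
    using that by (auto simp: line_def min_def max_def)
  have diag: "line \<alpha> \<beta> \<inter> diagonal \<alpha> \<subseteq> {Inr 0, Inl (\<beta>, \<beta>)}" for \<beta>
    by (auto simp: line_def diagonal_def)
  have "\<exists>p. A \<inter> B \<subseteq> {Inr 0, p}"
    using assms(1)
  proof (cases rule: proper_familyE)
    case 1
    with assms(2,3) show ?thesis
      by (cases rule: proper_familyE) (use diag in \<open>blast+\<close>)
  next
    case A: (2 \<beta>)
    show ?thesis
      using assms(2)
    proof (cases rule: proper_familyE)
      case 1
      then show ?thesis using A diag[of \<beta>] by blast
    next
      case (2 \<gamma>)
      then have "\<beta> \<noteq> \<gamma>" using A(2) assms(3) by blast
      then show ?thesis using A(2) 2(2) lines by blast
    qed blast+
  qed blast+
  then show thesis using that by blast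
qed

lemma Int_closed_line_family: "Int_closed (line_space \<alpha>) (line_family \<alpha>)"
  unfolding Int_closed_def
proof (intro allI impI)
  fix S assume S: "S \<subseteq> line_family \<alpha>"
  let ?I = "line_space \<alpha> \<inter> \<Inter>S"
  show "?I \<in> line_family \<alpha>"
  proof (cases "S \<subseteq> {line_space \<alpha>}")
    case True
    then have "?I = line_space \<alpha>" by auto
    then show ?thesis by (simp add: line_family_def)
  next
    case False
    then obtain A where A: "A \<in> S" "A \<in> proper_family \<alpha>" using S by (auto simp: line_family_def)
    show ?thesis
    proof (cases "S \<subseteq> {line_space \<alpha>, A}")
      case True
      then have "?I = A" using A proper_family_points(3)[OF A(2)] by auto
      then show ?thesis using A by (simp add: line_family_def)
    next
      case False
      then obtain B where B: "B \<in> S" "B \<in> proper_family \<alpha>" "A \<noteq> B"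
        using S by (auto simp: line_family_def)
      obtain p where p: "A \<inter> B \<subseteq> {Inr 0, p}"
        using proper_family_meet[OF A(2) B(2,3)] .
      have "Inr 0 \<in> C" if "C \<in> S" for C
        using that S proper_family_points(1)[of C \<alpha>] by (auto simp: line_family_def line_space_def)
      then have "Inr 0 \<in> ?I" by (simp add: line_space_def)
      moreover have "?I \<subseteq> {Inr 0, p}" using p A(1) B(1) by blast
      ultimately consider "?I = {Inr 0}" | "?I = {Inr 0, p}" "p \<noteq> Inr 0" by blast
      then show ?thesis
      proof cases
        case 1
        then show ?thesis by (simp add: line_family_def proper_family_def)
      next
        case 2
        then have "p \<in> A" "p \<in> line_space \<alpha>" using A(1) by blast+
        then obtain \<gamma> \<delta> where "p = Inl (\<gamma>, \<delta>)" "\<gamma> \<le> \<delta>" "\<delta> \<le> \<alpha>"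
          using 2(2) proper_family_points(2)[OF A(2)] by (auto simp: line_space_def)
        then have "{Inr 0, p} \<in> proper_family \<alpha>" unfolding proper_family_def by blast
        then show ?thesis using 2 by (simp add: line_family_def)
      qed
    qed
  qed
qed

text \<open>
  A point that is chosen in the set where it occurs first has to come from \<open>U\<close>.  This is how a
  sequence is forced to contain specific sets.
\<close>

lemma first_occurrence:
  fixes X :: "'o::wellorder \<Rightarrow> 'z set"
  assumes prem: "\<And>\<beta>. \<beta> \<le> \<alpha> \<Longrightarrow> \<mu> (X \<beta>) \<subseteq> U \<union> (\<Union>\<gamma>\<in>{..<\<beta>}. X \<gamma>)"
    and p: "p \<in> X \<beta>" "\<beta> \<le> \<alpha>" "p \<notin> U"
  obtains \<epsilon> where "\<epsilon> \<le> \<beta>" "p \<in> X \<epsilon>" "p \<notin> \<mu> (X \<epsilon>)"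
proof -
  define \<epsilon> where "\<epsilon> = (LEAST \<epsilon>. p \<in> X \<epsilon>)"
  have \<epsilon>: "p \<in> X \<epsilon>" "\<epsilon> \<le> \<beta>"
    using p(1) unfolding \<epsilon>_def by (rule LeastI, rule Least_le)
  have "p \<notin> X \<gamma>" if "\<gamma> < \<epsilon>" for \<gamma>
    using that not_less_Least unfolding \<epsilon>_def by blast
  moreover have "\<mu> (X \<epsilon>) \<subseteq> U \<union> (\<Union>\<gamma>\<in>{..<\<epsilon>}. X \<gamma>)"
    using \<epsilon>(2) p(2) by (intro prem) (rule order_trans)
  ultimately have "p \<notin> \<mu> (X \<epsilon>)" using p(3) by blast
  then show thesis using that \<epsilon> by blast
qed

text \<open>
  By the preceding lemma a line can enter the sequence only if its tag lies in \<open>U\<close>.  If the point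
  to be kept is a meeting point, \<open>U\<close> shares two points with the line, hence equals it.  If it is the
  common point, which only the last line drops, \<open>U\<close> lies inside the diagonal and so contains no
  meeting points; then the last line can be reached only through all the earlier ones.
\<close>

lemma mu_Cumt_line_family:
  fixes \<alpha> \<beta> :: "'o::wellorder"
  assumes "\<beta> < \<alpha>"
  shows "mu_Cumt (line_family \<alpha>) (line_mu \<alpha>) \<beta>"
  unfolding mu_Cumt_def
proof (intro ballI allI impI subsetI)
  fix U X x
  assume U: "U \<in> line_family \<alpha>" and X: "\<forall>\<gamma>\<le>\<beta>. X \<gamma> \<in> line_family \<alpha>"
    and "\<forall>\<delta>\<le>\<beta>. line_mu \<alpha> (X \<delta>) \<subseteq> U \<union> (\<Union>\<gamma>\<in>{..<\<delta>}. X \<gamma>)"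
    and x: "x \<in> X \<beta> \<inter> line_mu \<alpha> U"
  then have prem: "line_mu \<alpha> (X \<delta>) \<subseteq> U \<union> (\<Union>\<gamma>\<in>{..<\<delta>}. X \<gamma>)" if "\<delta> \<le> \<beta>" for \<delta>
    using that by blast
  have occurs: "\<exists>\<epsilon>\<le>\<delta>. p \<in> X \<epsilon> \<and> p \<notin> line_mu \<alpha> (X \<epsilon>)"
    if "p \<in> X \<delta>" "\<delta> \<le> \<beta>" "p \<notin> U" for p \<delta>
    by (rule first_occurrence[of \<beta> "line_mu \<alpha>" X U p \<delta>]) (use prem that in blast)+
  show "x \<in> line_mu \<alpha> (X \<beta>)"
  proof (cases "Inr 1 \<in> U")
    case True
    then have "x = Inr 1" using x by (simp add: line_mu_def)
    then show ?thesis using x by (simp add: line_mu_def)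
  next
    case False
    have no_top: "Inr 1 \<notin> X \<delta>" if \<delta>: "\<delta> \<le> \<beta>" for \<delta>
    proof
      assume "Inr 1 \<in> X \<delta>"
      then obtain \<epsilon> where "Inr 1 \<in> X \<epsilon>" "Inr 1 \<notin> line_mu \<alpha> (X \<epsilon>)"
        using occurs \<delta> False by blast
      then show False by (simp add: line_mu_def)
    qed
    have U': "U \<in> proper_family \<alpha>"
      using U False by (auto simp: line_family_def line_space_def)
    have tag: "Inl (\<gamma>, \<gamma>) \<in> U" if "Inl (\<gamma>, \<gamma>) \<in> X \<delta>" and \<delta>: "\<delta> \<le> \<beta>" for \<gamma> \<delta>
    proof (rule ccontr)
      assume "Inl (\<gamma>, \<gamma>) \<notin> U"
      with that(1) obtain \<epsilon> where "\<epsilon> \<le> \<delta>" "Inl (\<gamma>, \<gamma>) \<in> X \<epsilon>" "Inl (\<gamma>, \<gamma>) \<notin> line_mu \<alpha> (X \<epsilon>)"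
        using occurs \<delta> by blast
      then show False using no_top[of \<epsilon>] \<delta> by (auto simp: line_mu_def)
    qed
    show ?thesis
    proof (rule ccontr)
      assume "x \<notin> line_mu \<alpha> (X \<beta>)"
      then consider "x = Inr 0" "X \<beta> = line \<alpha> \<alpha>"
        | \<gamma> \<delta> where "x = Inl (\<gamma>, \<delta>)" "\<gamma> < \<delta>" "X \<beta> = line \<alpha> \<gamma>"
        using x no_top[of \<beta>] by (auto simp: line_mu_def)
      then show False
      proof cases
        case 1
        have "Inl (\<alpha>, \<alpha>) \<in> U" using tag[of \<alpha> \<beta>] tag_in_line[of \<alpha> \<alpha>] 1 by simp
        moreover have "U \<noteq> line \<alpha> \<alpha>" using x 1 False by (auto simp: line_mu_def)
        moreover have "\<gamma> = \<alpha>" if "Inl (\<alpha>, \<alpha>) \<in> line \<alpha> \<gamma>" for \<gamma>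
          using that by (auto simp: line_def)
        ultimately have "U \<subseteq> diagonal \<alpha>"
          by (rule_tac proper_familyE[OF U']) (auto simp: diagonal_def)
        then have no_meet: "Inl (\<gamma>, \<delta>) \<notin> U" if "\<gamma> < \<delta>" for \<gamma> \<delta>
          using that by (auto simp: diagonal_def)
        \<comment> \<open>A line occurs strictly after the lines of all smaller ordinals, hence not before
          the position given by its own ordinal.\<close>
        have late: "\<gamma> \<le> \<epsilon>" if "\<gamma> \<le> \<alpha>" "\<epsilon> \<le> \<beta>" "X \<epsilon> = line \<alpha> \<gamma>" for \<gamma> \<epsilon>
          using that
        proof (induction \<gamma> arbitrary: \<epsilon> rule: less_induct)
          case (less \<gamma>)
          have "\<delta> < \<epsilon>" if \<delta>: "\<delta> < \<gamma>" for \<delta>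
          proof -
            have "Inl (\<delta>, \<gamma>) \<in> line_mu \<alpha> (X \<epsilon>)"
              using less.prems \<delta> no_top[of \<epsilon>] line_eq_iff[of \<gamma> \<alpha> \<delta>] meet_in_line(2)[of \<delta> \<gamma> \<alpha>]
              by (auto simp: line_mu_def)
            then obtain \<epsilon>1 where \<epsilon>1: "\<epsilon>1 < \<epsilon>" "Inl (\<delta>, \<gamma>) \<in> X \<epsilon>1"
              using prem[OF less.prems(2)] no_meet[OF \<delta>] by blast
            have le: "\<epsilon>1 \<le> \<beta>" using \<epsilon>1 less.prems(2) by simp
            obtain \<epsilon>2 where \<epsilon>2: "\<epsilon>2 \<le> \<epsilon>1" "Inl (\<delta>, \<gamma>) \<in> X \<epsilon>2" "Inl (\<delta>, \<gamma>) \<notin> line_mu \<alpha> (X \<epsilon>2)"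
              using occurs[OF \<epsilon>1(2) le no_meet[OF \<delta>]] by blast
            have le2: "\<epsilon>2 \<le> \<beta>" using \<epsilon>2(1) le by simp
            then have "X \<epsilon>2 = line \<alpha> \<delta>"
              using \<epsilon>2(2,3) no_top[of \<epsilon>2] by (auto simp: line_mu_def)
            then have "\<delta> \<le> \<epsilon>2" using less.IH[OF \<delta>, of \<epsilon>2] \<delta> less.prems(1) le2 by simp
            then show ?thesis using \<epsilon>1(1) \<epsilon>2(1) by simp
          qed
          then show ?case using not_less by blast
        qed
        show False using late[of \<alpha> \<beta>] 1 assms by simp
      next
        case 2
        have "\<gamma> \<le> \<alpha>" using x 2 by (auto simp: line_def)
        then have "Inl (\<gamma>, \<gamma>) \<in> U" using tag[of \<gamma> \<beta>] tag_in_line[of \<gamma> \<alpha>] 2 by simp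
        moreover have "Inl (\<gamma>, \<delta>) \<in> U" using x 2 line_mu_subset by blast
        ultimately have "U = line \<alpha> \<gamma>" using two_points_line[OF U'] 2 by blast
        then show False using x 2 False by (auto simp: line_mu_def)
      qed
    qed
  qed
qed

lemma not_mu_Cum_line_family:
  fixes \<alpha> :: "'o::wellorder"
  assumes "ord_zero < \<alpha>"
  shows "\<not> mu_Cum (line_family \<alpha>) (line_mu \<alpha>) \<alpha>"
proof
  assume "mu_Cum (line_family \<alpha>) (line_mu \<alpha>) \<alpha>"
  then have "(\<Inter>\<gamma>\<in>{..\<alpha>}. line \<alpha> \<gamma>) \<inter> line_mu \<alpha> (diagonal \<alpha>) \<subseteq> line_mu \<alpha> (line \<alpha> \<alpha>)"
  proof (rule mu_CumD[where X = "line \<alpha>"])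
    fix \<beta> assume \<beta>: "\<beta> \<le> \<alpha>"
    show "line_mu \<alpha> (line \<alpha> \<beta>) \<subseteq> diagonal \<alpha> \<union> (\<Union>\<gamma>\<in>{..<\<beta>}. line \<alpha> \<gamma>)"
    proof
      fix p assume p: "p \<in> line_mu \<alpha> (line \<alpha> \<beta>)"
      then consider "p = Inr 0"
        | \<gamma> \<delta> where "p = Inl (\<gamma>, \<delta>)" "\<gamma> \<le> \<delta>" "\<delta> \<le> \<alpha>" "\<gamma> = \<beta> \<or> \<delta> = \<beta>"
        using line_mu_subset[of \<alpha> "line \<alpha> \<beta>"] unfolding line_def by blast
      then show "p \<in> diagonal \<alpha> \<union> (\<Union>\<gamma>\<in>{..<\<beta>}. line \<alpha> \<gamma>)"
      proof cases
        case 1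
        then show ?thesis by (simp add: diagonal_def)
      next
        case (2 \<gamma> \<delta>)
        show ?thesis
        proof (cases "\<gamma> = \<delta>")
          case True
          then show ?thesis using 2 by (simp add: diagonal_def)
        next
          case False
          then have less: "\<gamma> < \<delta>" using 2(2) by simp
          have "Inr 1 \<notin> line \<alpha> \<beta>" by (simp add: line_def)
          then have "\<gamma> \<noteq> \<beta>" using p 2(1) less by (auto simp: line_mu_def)
          then have "\<gamma> \<in> {..<\<beta>}" "p \<in> line \<alpha> \<gamma>"
            using 2 less meet_in_line(1)[of \<gamma> \<delta> \<alpha>] by auto
          then show ?thesis by blast
        qed
      qed
    qed
  qed (auto simp: line_family_def proper_family_def)
  moreover have "Inr 0 \<in> (\<Inter>\<gamma>\<in>{..\<alpha>}. line \<alpha> \<gamma>)" by (simp add: line_def)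
  moreover have "Inl (ord_zero, \<alpha>) \<in> line \<alpha> \<alpha>" "Inl (ord_zero, \<alpha>) \<notin> diagonal \<alpha>"
    using assms meet_in_line(2)[of ord_zero \<alpha> \<alpha>] by (simp_all add: diagonal_def)
  then have "diagonal \<alpha> \<noteq> line \<alpha> \<alpha>" by metis
  then have "Inr 0 \<in> line_mu \<alpha> (diagonal \<alpha>)" by (simp add: line_mu_def diagonal_def)
  moreover have "Inr 0 \<notin> line_mu \<alpha> (line \<alpha> \<alpha>)" by (simp add: line_mu_def line_def)
  ultimately show False by blast
qed

lemma pref_choice_fun_line:
  fixes \<alpha> :: "'o::wellorder"
  assumes "ord_zero < \<alpha>"
  shows "pref_choice_fun (line_space \<alpha>) (line_family \<alpha>) (line_mu \<alpha>)"
proof -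
  have "mu_Sub (line_family \<alpha>) (line_mu \<alpha>)"
    using line_mu_subset by (auto simp: mu_Sub_def)
  moreover from this have "mu_PR (line_family \<alpha>) (line_mu \<alpha>)"
    using mu_Cum_zero_imp_mu_PR mu_Cumt_imp_mu_Cum[OF mu_Cumt_line_family[OF assms]] by blast
  moreover have "line_family \<alpha> \<subseteq> Pow (line_space \<alpha>)"
    using proper_family_points(3) by (auto simp: line_family_def)
  ultimately show ?thesis
    using line_mu_subset unfolding pref_choice_fun_def choice_fun_def by blast
qed

section \<open>Validities and separations\<close>

theorem fact4p1:
  shows
  "(\<forall>(\<alpha> :: 'o :: wellorder) \<beta> Z (\<Y> :: 'z set set) \<mu>. \<beta> \<le> \<alpha> \<and> pref_choice_fun Z \<Y> \<mu> \<and> mu_Cum \<Y> \<mu> \<alpha> \<longrightarrow> mu_Cum \<Y> \<mu> \<beta>) \<and>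
   (\<forall>(\<alpha> :: 'o :: wellorder) \<beta> Z (\<Y> :: 'z set set) \<mu>. \<beta> \<le> \<alpha> \<and> pref_choice_fun Z \<Y> \<mu> \<and> mu_Cumt \<Y> \<mu> \<alpha> \<longrightarrow> mu_Cumt \<Y> \<mu> \<beta>) \<and>
   (\<forall>(\<alpha> :: 'o :: wellorder) Z (\<Y> :: 'z set set) (\<U> :: ('z \<times> 'i) set) R. \<Y> \<subseteq> Pow Z \<and> pref_struct \<U> R \<and> smooth \<Y> \<U> R
      \<longrightarrow> mu_Cum \<Y> (pref_mu \<U> R) \<alpha>) \<and>
   (\<forall>(\<alpha> :: 'o :: wellorder) Z (\<Y> :: 'z set set) W R. \<Y> \<subseteq> Pow Z \<and> pref_struct1 W R \<and> smooth1 \<Y> W R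
      \<longrightarrow> mu_Cum \<Y> (pref_mu1 W R) \<alpha>) \<and>
   (\<forall>(\<alpha> :: 'o :: wellorder) Z (\<Y> :: 'z set set) (\<U> :: ('z \<times> 'i) set) R. \<Y> \<subseteq> Pow Z \<and> pref_struct \<U> R \<and> trans R \<and> smooth \<Y> \<U> R
      \<longrightarrow> mu_Cumt \<Y> (pref_mu \<U> R) \<alpha>) \<and>
   (\<forall>(\<alpha> :: 'o :: wellorder) Z (\<Y> :: 'z set set) W R. \<Y> \<subseteq> Pow Z \<and> pref_struct1 W R \<and> trans R \<and> smooth1 \<Y> W R
      \<longrightarrow> mu_Cumt \<Y> (pref_mu1 W R) \<alpha>) \<and>
   (\<forall>\<alpha> :: 'o :: wellorder. ord_zero < \<alpha> \<longrightarrow>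
      (\<exists>Z \<Y> (\<U> :: (nat \<times> nat) set) R. pref_choice_fun Z \<Y> (pref_mu \<U> R) \<and> pref_struct \<U> R \<and> smooth \<Y> \<U> R
        \<and> Int_closed Z \<Y> \<and> \<not> mu_Cumt \<Y> (pref_mu \<U> R) \<alpha>)) \<and>
   (\<forall>\<alpha> :: 'o :: wellorder. ord_zero < \<alpha> \<longrightarrow>
      (\<exists>Z \<Y> (W :: nat set) R. pref_choice_fun Z \<Y> (pref_mu1 W R) \<and> pref_struct1 W R \<and> smooth1 \<Y> W R
        \<and> Int_closed Z \<Y> \<and> \<not> mu_Cumt \<Y> (pref_mu1 W R) \<alpha>)) \<and>
   (\<forall>(\<alpha> :: 'o :: wellorder) \<beta> Z (\<Y> :: 'z set set) \<mu>. \<beta> \<le> \<alpha> \<and> pref_choice_fun Z \<Y> \<mu> \<and> mu_Cum \<Y> \<mu> \<beta> \<and> fin_Un_closed \<Y> \<longrightarrow> mu_Cum \<Y> \<mu> \<alpha>) \<and>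
   (\<forall>(\<alpha> :: 'o :: wellorder) \<beta> Z (\<Y> :: 'z set set) \<mu>. \<beta> \<le> \<alpha> \<and> pref_choice_fun Z \<Y> \<mu> \<and> mu_Cumt \<Y> \<mu> \<beta> \<and> fin_Un_closed \<Y> \<longrightarrow> mu_Cumt \<Y> \<mu> \<alpha>) \<and>
   (\<forall>\<alpha> :: 'o :: wellorder. ord_zero < \<alpha> \<longrightarrow>
      (\<exists>Z (\<Y> :: ('o \<times> 'o + nat) set set) \<mu>. pref_choice_fun Z \<Y> \<mu> \<and> (\<forall>\<beta><\<alpha>. mu_Cumt \<Y> \<mu> \<beta>) \<and> mu_CUM \<Y> \<mu> \<and> Int_closed Z \<Y> \<and> \<not> mu_Cum \<Y> \<mu> \<alpha>)) \<and>
   (\<forall>(\<alpha> :: 'o :: wellorder) Z (\<Y> :: 'z set set) \<mu>. pref_choice_fun Z \<Y> \<mu> \<and> mu_Cumt \<Y> \<mu> \<alpha> \<longrightarrow> mu_Cum \<Y> \<mu> \<alpha>) \<and>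
   (\<forall>\<alpha> :: 'o :: wellorder. ord_zero < \<alpha> \<longrightarrow>
      (\<exists>Z (\<Y> :: nat set set) \<mu>. pref_choice_fun Z \<Y> \<mu> \<and> mu_Cum \<Y> \<mu> \<alpha> \<and> Int_closed Z \<Y> \<and> \<not> mu_Cumt \<Y> \<mu> \<alpha>)) \<and>
   (\<forall>(\<alpha> :: 'o :: wellorder) Z (\<Y> :: 'z set set) \<mu>. pref_choice_fun Z \<Y> \<mu> \<and> mu_Cum \<Y> \<mu> \<alpha> \<and> fin_Un_closed \<Y> \<longrightarrow> mu_Cumt \<Y> \<mu> \<alpha>) \<and>
   (\<forall>Z (\<Y> :: 'z set set) \<mu>. pref_choice_fun Z \<Y> \<mu> \<and> mu_CUM \<Y> \<mu> \<and> fin_Un_closed \<Y> \<longrightarrow> 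
      (\<forall>A\<in>\<Y>. \<forall>B\<in>\<Y>. \<mu> A \<subseteq> B \<longrightarrow> \<mu> (A \<union> B) = \<mu> B) \<and>
      (\<forall>X\<in>\<Y>. \<forall>Y\<in>\<Y>. \<forall>U\<in>\<Y>. \<mu> X \<subseteq> U \<and> U \<subseteq> Y \<longrightarrow> \<mu> (Y \<union> X) = \<mu> Y) \<and>
      (\<forall>X\<in>\<Y>. \<forall>Y\<in>\<Y>. \<forall>U\<in>\<Y>. \<mu> X \<subseteq> U \<and> U \<subseteq> Y \<longrightarrow> \<mu> Y \<inter> X \<subseteq> \<mu> U)) \<and>
   (\<forall>(\<alpha> :: 'o :: wellorder) Z (\<Y> :: 'z set set) \<mu>. pref_choice_fun Z \<Y> \<mu> \<and> mu_Cum \<Y> \<mu> \<alpha> \<longrightarrow> mu_CUM \<Y> \<mu>) \<and>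
   (\<forall>(\<alpha> :: 'o :: wellorder) Z (\<Y> :: 'z set set) \<mu>. pref_choice_fun Z \<Y> \<mu> \<and> mu_CUM \<Y> \<mu> \<and> fin_Un_closed \<Y> \<longrightarrow> mu_Cum \<Y> \<mu> \<alpha>) \<and>
   (\<forall>Z (\<Y> :: 'z set set) \<mu>. pref_choice_fun Z \<Y> \<mu> \<and> mu_CUM \<Y> \<mu> \<and> fin_Int_closed \<Y> \<longrightarrow> mu_Cum \<Y> \<mu> (ord_zero :: 'o :: wellorder)) \<and>
   (\<forall>(\<alpha> :: 'o :: wellorder) Z (\<Y> :: 'z set set) \<mu>. pref_choice_fun Z \<Y> \<mu> \<and> mu_Cumt \<Y> \<mu> \<alpha> \<longrightarrow> mu_CUM \<Y> \<mu>) \<and>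
   (\<forall>(\<alpha> :: 'o :: wellorder) Z (\<Y> :: 'z set set) \<mu>. pref_choice_fun Z \<Y> \<mu> \<and> mu_CUM \<Y> \<mu> \<and> fin_Un_closed \<Y> \<longrightarrow> mu_Cumt \<Y> \<mu> \<alpha>) \<and>
   (\<forall>\<alpha> :: 'o :: wellorder. ord_zero < \<alpha> \<longrightarrow>
      (\<exists>Z (\<Y> :: nat set set) \<mu>. pref_choice_fun Z \<Y> \<mu> \<and> mu_CUM \<Y> \<mu> \<and> \<not> mu_Cumt \<Y> \<mu> \<alpha>)) \<and>
   (\<forall>Z (\<Y> :: 'z set set) \<mu>. choice_fun Z \<Y> \<mu> \<and> mu_Cum \<Y> \<mu> (ord_zero :: 'o :: wellorder) \<longrightarrow> mu_PR \<Y> \<mu>)"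
proof (intro conjI, goal_cases)
  case 1 show ?case
    using mu_Cum_downward pref_choice_fun_mu_Sub by metis
next
  case 2 show ?case
    using mu_Cumt_downward pref_choice_fun_mu_Sub by metis
next
  case 3 show ?case using mu_Cum_smooth by blast
next
  case 4 show ?case using mu_Cum_smooth1 by blast
next
  case 5 show ?case using mu_Cumt_smooth_trans by blast
next
  case 6 show ?case using mu_Cumt_smooth1_trans by blast
next
  case 7 show ?case
  proof (intro allI impI)
    fix \<alpha> :: 'o assume "ord_zero < \<alpha>"
    then show "\<exists>Z \<Y> (\<U> :: (nat \<times> nat) set) R. pref_choice_fun Z \<Y> (pref_mu \<U> R) \<and> pref_struct \<U> R
        \<and> smooth \<Y> \<U> R \<and> Int_closed Z \<Y> \<and> \<not> mu_Cumt \<Y> (pref_mu \<U> R) \<alpha>"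
      using pref_choice_fun_chain not_mu_Cumt_chain Int_closed_chain
        smooth_one_copy[OF smooth_chain, of "0 :: nat"]
        pref_struct_one_copy[OF pref_struct_chain, of "0 :: nat"]
      by (metis pref_mu_one_copy)
  qed
next
  case 8 show ?case
    using pref_choice_fun_chain pref_struct_chain smooth_chain Int_closed_chain not_mu_Cumt_chain by metis
next
  case 9 show ?case
    using mu_CUM_Un_imp_mu_Cumt mu_Cumt_imp_mu_Cum pref_mu_Cum_imp_mu_CUM by metis
next
  case 10 show ?case
    using mu_CUM_Un_imp_mu_Cumt mu_Cumt_imp_mu_Cum pref_mu_Cum_imp_mu_CUM by metis
next
  case 11 show ?case
  proof (intro allI impI)
    fix \<alpha> :: 'o assume \<alpha>: "ord_zero < \<alpha>"
    have pref: "pref_choice_fun (line_space \<alpha>) (line_family \<alpha>) (line_mu \<alpha>)"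
      using pref_choice_fun_line[OF \<alpha>] .
    have "mu_CUM (line_family \<alpha>) (line_mu \<alpha>)"
      using pref_mu_Cum_imp_mu_CUM[OF pref mu_Cumt_imp_mu_Cum[OF mu_Cumt_line_family[OF \<alpha>]]] .
    then show "\<exists>Z (\<Y> :: ('o \<times> 'o + nat) set set) \<mu>. pref_choice_fun Z \<Y> \<mu> \<and>
        (\<forall>\<beta><\<alpha>. mu_Cumt \<Y> \<mu> \<beta>) \<and> mu_CUM \<Y> \<mu> \<and> Int_closed Z \<Y> \<and> \<not> mu_Cum \<Y> \<mu> \<alpha>"
      using pref mu_Cumt_line_family Int_closed_line_family not_mu_Cum_line_family[OF \<alpha>] by blast
  qed
next
  case 12 show ?case using mu_Cumt_imp_mu_Cum by blast
next
  case 13 show ?case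
    using pref_choice_fun_chain mu_Cum_smooth1[OF smooth_chain] Int_closed_chain not_mu_Cumt_chain by metis
next
  case 14 show ?case using mu_CUM_Un_imp_mu_Cumt pref_mu_Cum_imp_mu_CUM by metis
next
  case 15 show ?case
  proof (intro allI impI, elim conjE)
    fix Z \<Y> and \<mu> :: "'z set \<Rightarrow> 'z set"
    assume "pref_choice_fun Z \<Y> \<mu>" "mu_CUM \<Y> \<mu>" "fin_Un_closed \<Y>"
    then interpret cumulative_Un \<Y> \<mu> by (rule cumulative_UnI)
    show "(\<forall>A\<in>\<Y>. \<forall>B\<in>\<Y>. \<mu> A \<subseteq> B \<longrightarrow> \<mu> (A \<union> B) = \<mu> B) \<and>
      (\<forall>X\<in>\<Y>. \<forall>Y\<in>\<Y>. \<forall>U\<in>\<Y>. \<mu> X \<subseteq> U \<and> U \<subseteq> Y \<longrightarrow> \<mu> (Y \<union> X) = \<mu> Y) \<and>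
      (\<forall>X\<in>\<Y>. \<forall>Y\<in>\<Y>. \<forall>U\<in>\<Y>. \<mu> X \<subseteq> U \<and> U \<subseteq> Y \<longrightarrow> \<mu> Y \<inter> X \<subseteq> \<mu> U)"
      by (intro conjI ballI impI; (elim conjE)?;
          rule mu_Un_absorb mu_Un_absorb_between mu_Int_subset_between; assumption)
  qed
next
  case 16 show ?case
    by (intro allI impI, elim conjE) (rule pref_mu_Cum_imp_mu_CUM)
next
  case 17 show ?case by (blast intro: mu_CUM_Un_imp_mu_Cumt mu_Cumt_imp_mu_Cum)
next
  case 18 show ?case
  proof (intro allI impI, elim conjE)
    fix Z \<Y> and \<mu> :: "'z set \<Rightarrow> 'z set"
    assume *: "pref_choice_fun Z \<Y> \<mu>" "mu_CUM \<Y> \<mu>" "fin_Int_closed \<Y>"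
    have "A \<inter> B \<in> \<Y>" if "A \<in> \<Y>" "B \<in> \<Y>" for A B
      using that *(3)[unfolded fin_Int_closed_def, rule_format, of "{A, B}"] by simp
    then show "mu_Cum \<Y> \<mu> (ord_zero :: 'o)"
      by (rule mu_CUM_Int_imp_mu_Cum_zero[OF pref_choice_fun_mu_PR[OF *(1)]
            pref_choice_fun_mu_Sub[OF *(1)] *(2)])
  qed
next
  case 19 show ?case
    by (intro allI impI, elim conjE) (rule pref_mu_Cum_imp_mu_CUM[OF _ mu_Cumt_imp_mu_Cum])
next
  case 20 show ?case
    by (intro allI impI, elim conjE) (rule mu_CUM_Un_imp_mu_Cumt)
next
  case 21 show ?case
    using pref_choice_fun_chain mu_CUM_chain not_mu_Cumt_chain by metis
next
  case 22 show ?case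
  proof (intro allI impI, elim conjE)
    fix Z \<Y> and \<mu> :: "'z set \<Rightarrow> 'z set"
    assume "choice_fun Z \<Y> \<mu>" and cum: "mu_Cum \<Y> \<mu> (ord_zero :: 'o)"
    then have "mu_Sub \<Y> \<mu>" by (simp add: choice_fun_def)
    then show "mu_PR \<Y> \<mu>" using cum by (rule mu_Cum_zero_imp_mu_PR)
  qed
qed

end
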